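(* There is an infinitely smooth $R_\theta$-invariant convex body $K$ in $\mathbb{R}^6$ contained in the unit ball for which the distribution $$\frac{\|x\|_K^{-2}}{1-\left(\frac{|x|}{\|x\|_K}\right)^2}$$ on $\mathbb{R}^6$ is not positive definite.
   Context: $|\cdot|$ is the Euclidean norm; "unit ball" means the open Euclidean unit ball $\{|x|<1\}$. A convex body is a compact convex set having the origin as an interior point. Its Minkowski functional is $\|x\|_K=\min\{a\ge 0:x\in aK\}$. $K$ is infinitely smooth if the restriction of $\|\cdot\|_K$ to the unit sphere $S^5$ is of class $C^k$ for every $k\in\mathbb{N}$. Writing points of $\mathbb{R}^{6}$ as $\xi=(\xi_{11},\xi_{12},\xi_{21},\xi_{22},\xi_{31},\xi_{32})$, a body $K$ is $R_\theta$-invariant if for every $\theta\in[0,2\pi]$ and every $\xi\in\mathbb{R}^6$, $\|\xi\|_K=\|(R_\theta(\xi_{11},\xi_{12}),R_\theta(\xi_{21},\xi_{22}),R_\theta(\xi_{31},\xi_{32}))\|_K$, where $R_\theta$ is the counterclockwise rotation of $\mathbb{R}^2$ by the angle $\theta$ about the origin. The displayed function is locally integrable on $\mathbb{R}^6$, homogeneous of degree $-2$, and is regarded as a tempered distribution. A distribution $f$ is positive definite if $\langle f,\varphi*\overline{\varphi}(-x)\rangle\ge 0$ for every Schwartz test function $\varphi$; equivalently, its Fourier transform satisfies $\langle\hat f,\varphi\rangle\ge 0$ for every non-negative test function $\varphi$. *)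

theory Defs
  imports "HOL-Analysis.Analysis"
begin

definition convex_body :: "'a::euclidean_space set \<Rightarrow> bool" where
  "convex_body K \<longleftrightarrow> compact K \<and> convex K \<and> 0 \<in> interior K"

text \<open>For a convex body the minimum is attained, so the least element below exists.\<close>

definition minkowski :: "'a::euclidean_space set \<Rightarrow> 'a \<Rightarrow> real" where
  "minkowski K x = (LEAST a. 0 \<le> a \<and> x \<in> (\<lambda>y. a *\<^sub>R y) ` K)"

text \<open>Only meaningful for open \<open>U\<close>. All directional derivatives of order \<open>k\<close>
  are required to exist and be continuous.\<close>

fun Ck_on :: "nat \<Rightarrow> 'a::euclidean_space set \<Rightarrow> ('a \<Rightarrow> 'b::real_normed_vector) \<Rightarrow> bool" where
  "Ck_on 0 U f \<longleftrightarrow> continuous_on U f"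
| "Ck_on (Suc k) U f \<longleftrightarrow> (\<forall>x\<in>U. f differentiable (at x)) \<and>
     (\<forall>v. Ck_on k U (\<lambda>x. frechet_derivative f (at x) v))"

text \<open>A function on a subset \<open>S\<close> (for us the sphere) is of class \<open>C\<^sup>k\<close> if near each point of
  \<open>S\<close> it extends to a \<open>C\<^sup>k\<close> function on an open set of the ambient space; only the values
  of \<open>g\<close> on \<open>S\<close> matter.\<close>

definition Ck_on_subset :: "nat \<Rightarrow> 'a::euclidean_space set \<Rightarrow> ('a \<Rightarrow> real) \<Rightarrow> bool" where
  "Ck_on_subset k S g \<longleftrightarrow>
     (\<forall>x\<in>S. \<exists>U h. open U \<and> x \<in> U \<and> Ck_on k U h \<and> (\<forall>y\<in>U \<inter> S. h y = g y))"

definition infinitely_smooth :: "'a::euclidean_space set \<Rightarrow> bool" where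
  "infinitely_smooth K \<longleftrightarrow> (\<forall>k. Ck_on_subset k (sphere 0 1) (minkowski K))"

definition rot :: "real \<Rightarrow> real^6 \<Rightarrow> real^6" where
  "rot \<theta> \<xi> = vector
     [cos \<theta> * \<xi>$1 - sin \<theta> * \<xi>$2, sin \<theta> * \<xi>$1 + cos \<theta> * \<xi>$2,
      cos \<theta> * \<xi>$3 - sin \<theta> * \<xi>$4, sin \<theta> * \<xi>$3 + cos \<theta> * \<xi>$4,
      cos \<theta> * \<xi>$5 - sin \<theta> * \<xi>$6, sin \<theta> * \<xi>$5 + cos \<theta> * \<xi>$6]"

lemma rot_nth:
  "rot \<theta> \<xi> $ 1 = cos \<theta> * \<xi>$1 - sin \<theta> * \<xi>$2"
  "rot \<theta> \<xi> $ 2 = sin \<theta> * \<xi>$1 + cos \<theta> * \<xi>$2"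
  "rot \<theta> \<xi> $ 3 = cos \<theta> * \<xi>$3 - sin \<theta> * \<xi>$4"
  "rot \<theta> \<xi> $ 4 = sin \<theta> * \<xi>$3 + cos \<theta> * \<xi>$4"
  "rot \<theta> \<xi> $ 5 = cos \<theta> * \<xi>$5 - sin \<theta> * \<xi>$6"
  "rot \<theta> \<xi> $ 6 = sin \<theta> * \<xi>$5 + cos \<theta> * \<xi>$6"
  by (simp_all add: rot_def vector_def)

definition R_theta_invariant :: "(real^6) set \<Rightarrow> bool" where
  "R_theta_invariant K \<longleftrightarrow>
     (\<forall>\<theta>\<in>{0..2*pi}. \<forall>\<xi>. minkowski K \<xi> = minkowski K (rot \<theta> \<xi>))"

fun iterated_deriv :: "'a list \<Rightarrow> ('a::euclidean_space \<Rightarrow> complex) \<Rightarrow> 'a \<Rightarrow> complex" where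
  "iterated_deriv [] f = f"
| "iterated_deriv (v # vs) f = (\<lambda>x. frechet_derivative (iterated_deriv vs f) (at x) v)"

text \<open>The lists \<open>vs\<close> of basis vectors play the role of the multi-indices of the partial
  derivatives.\<close>

definition schwartz :: "('a::euclidean_space \<Rightarrow> complex) \<Rightarrow> bool" where
  "schwartz \<phi> \<longleftrightarrow> (\<forall>k. Ck_on k UNIV \<phi>) \<and>
     (\<forall>N vs. set vs \<subseteq> Basis \<longrightarrow> (\<exists>C. \<forall>x. norm x ^ N * norm (iterated_deriv vs \<phi> x) \<le> C))"

definition convolution :: "('a::euclidean_space \<Rightarrow> complex) \<Rightarrow> ('a \<Rightarrow> complex) \<Rightarrow> 'a \<Rightarrow> complex" where
  "convolution f g x = (LINT y|lborel. f y * g (x - y))"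

definition distribution_of :: "('a::euclidean_space \<Rightarrow> real) \<Rightarrow> ('a \<Rightarrow> complex) \<Rightarrow> complex" where
  "distribution_of f \<phi> = (LINT x|lborel. complex_of_real (f x) * \<phi> x)"

definition positive_definite :: "(('a::euclidean_space \<Rightarrow> complex) \<Rightarrow> complex) \<Rightarrow> bool" where
  "positive_definite T \<longleftrightarrow>
     (\<forall>\<phi>. schwartz \<phi> \<longrightarrow> T (convolution \<phi> (\<lambda>x. cnj (\<phi> (- x)))) \<in> \<real>\<^sub>\<ge>\<^sub>0)"

end

theory Submission
  imports Defs "HOL-Probability.Distributions" "HOL-Real_Asymp.Real_Asymp"
begin

text \<open>
On the complement of the origin the density equals \<open>1 / (\<parallel>x\<parallel>\<^sup>2 - |x|\<^sup>2)\<close>, with \<open>\<parallel>x\<parallel>\<close> the Minkowski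
functional. So one may prescribe any smooth positive invariant function \<open>f\<close> that is homogeneous of
degree \<open>-2\<close> and put \<open>\<parallel>x\<parallel>\<^sup>2 = |x|\<^sup>2 + 1 / f(x)\<close>: after multiplication of \<open>f\<close> by a large constant,
this is a small smooth perturbation of the Euclidean norm, hence still the Minkowski functional
of a convex body, which lies in the open unit ball because \<open>\<parallel>x\<parallel> > |x|\<close>. It remains to find an \<open>f\<close> that is not positive definite. The choice
here is
  \<open>f(x) = 8 (4 |z\<^sub>1|\<^sup>2 + |x|\<^sup>2)\<^sup>2 / |x|\<^sup>6\<close>, where \<open>z\<^sub>1 = x\<^sub>1 + i x\<^sub>2\<close>.

Failure of positive definiteness is seen on the test function \<open>x\<^sub>1 exp (- 2 |x|\<^sup>2)\<close>, whose
autocorrelation is a positive multiple of \<open>(1 - 2 x\<^sub>1\<^sup>2) exp (- |x|\<^sup>2)\<close>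
(\<open>convolution_test_function\<close>). Integrating this in polar coordinates against a function
\<open>g(s) / |x|\<^sup>2\<close> of \<open>s = |z\<^sub>1|\<^sup>2 / |x|\<^sup>2\<close> gives a positive multiple of the integral of
\<open>g(s) (1 - 2 s) (1 - s)\<close> over \<open>0 \<le> s \<le> 1\<close>: the factor \<open>1 - s\<close> is the density of \<open>s\<close> on the sphere up
to normalisation, and \<open>1 - 2 s\<close> comes from the radial integral after \<open>x\<^sub>1\<^sup>2\<close> has been averaged over
the rotations to \<open>|z\<^sub>1|\<^sup>2 / 2\<close>. For \<open>g(s) = 1, s, s\<^sup>2\<close> the values are \<open>1/6\<close>, \<open>0\<close> and \<open>-1/60\<close>. The function \<open>f\<close> above corresponds to \<open>128 (s + 1/4)\<^sup>2\<close>, where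
\<open>1/4\<close> keeps \<open>f\<close> positive, and \<open>-1/60 + 1/(6 \<cdot> 16) = -1/160\<close> is negative. Below, polar
coordinates are replaced by writing \<open>f\<close> as a Laplace transform in \<open>|x|\<^sup>2\<close>
(\<open>laplace_representation\<close>), which reduces everything to Gaussian moments and to rational integrals
in one variable (\<open>integral_against_gaussian\<close>, \<open>integral_against_weighted_gaussian\<close>).

Convexity rests on the fact that \<open>\<parallel>x\<parallel>\<^sup>2\<close> is a maximum of positive semidefinite quadratic forms
(\<open>support_form_le_gauge_sq\<close>, \<open>gauge_sq_eq_support_form\<close>): \<open>1 / f\<close> is a convex function of the two
quadratic forms \<open>|x|\<^sup>2\<close> and \<open>4 |z\<^sub>1|\<^sup>2 + |x|\<^sup>2\<close>, hence the maximum of its tangent planes. The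
factor \<open>8\<close> in \<open>f\<close> makes each of these forms positive semidefinite once \<open>|x|\<^sup>2\<close> is added.
\<close>

section \<open>The convex body\<close>

lemma UNIV_6: "(UNIV :: 6 set) = {1, 2, 3, 4, 5, 6}"
proof -
  have "i \<in> {1, 2, 3, 4, 5, 6}" for i :: 6
  proof (induct i)
    case (of_int z)
    then have "z = 0 \<or> z = 1 \<or> z = 2 \<or> z = 3 \<or> z = 4 \<or> z = 5" by fastforce
    then show ?case by auto
  qed
  then show ?thesis by auto
qed

lemma norm_sq_6:
  "(norm (x :: real^6))\<^sup>2 = (x$1)\<^sup>2 + (x$2)\<^sup>2 + (x$3)\<^sup>2 + (x$4)\<^sup>2 + (x$5)\<^sup>2 + (x$6)\<^sup>2"
  unfolding power2_norm_eq_inner inner_vec_def UNIV_6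
  by (simp add: power2_eq_square)

text \<open>When \<open>\<real>\<^sup>6\<close> is read as the space of triples of complex numbers, the rotations multiply by unit
scalars. Hence every function of the norm and of the modulus of the first entry \<open>z\<^sub>1\<close> is invariant.\<close>

definition z1sq :: "real^6 \<Rightarrow> real" where
  "z1sq x = (x$1)\<^sup>2 + (x$2)\<^sup>2"

lemma z1sq_nonneg [simp]: "0 \<le> z1sq x"
  by (simp add: z1sq_def)

lemma z1sq_le_norm_sq: "z1sq x \<le> (norm x)\<^sup>2"
  by (simp add: z1sq_def norm_sq_6)

text \<open>The square of the future Minkowski functional. The term added to \<open>|x|\<^sup>2\<close> is the reciprocal of the
density that is to fail to be positive definite; the factor \<open>1/8\<close> makes it small enough for
convexity to survive.\<close>

definition gauge_sq :: "real^6 \<Rightarrow> real" where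
  "gauge_sq x = (norm x)\<^sup>2 + (norm x)^6 / (8 * (4 * z1sq x + (norm x)\<^sup>2)\<^sup>2)"

text \<open>The quadratic forms of which \<^const>\<open>gauge_sq\<close> is the maximum over \<open>0 \<le> \<nu> \<le> 1\<close>. Writing
\<open>u = |x|\<^sup>2\<close> and \<open>d = 4 |z\<^sub>1|\<^sup>2 + u\<close>, they arise by replacing the convex function \<open>u\<^sup>3 / d\<^sup>2\<close> of
\<open>(u, d)\<close> by its tangent planes \<open>3 \<nu>\<^sup>2 u - 2 \<nu>\<^sup>3 d\<close>, which are indexed by the ratio \<open>\<nu> = u / d\<close>
of the point of contact.\<close>

definition support_form :: "real \<Rightarrow> real^6 \<Rightarrow> real" where
  "support_form \<nu> x = (1 + (3 * \<nu>\<^sup>2 - 2 * \<nu>^3) / 8) * (norm x)\<^sup>2 - \<nu>^3 * z1sq x"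

definition body :: "(real^6) set" where
  "body = {x. gauge_sq x \<le> 1}"

lemma denominator_pos: "x \<noteq> 0 \<Longrightarrow> 0 < 4 * z1sq x + (norm x)\<^sup>2"
  by (simp add: add_nonneg_pos)

lemma norm_pow6: "(norm x)^6 = ((norm x)\<^sup>2)^3"
  by (simp flip: power_mult)

lemma tangent_inequality:
  fixes u d \<nu> :: real
  assumes "0 < u" "0 < d" "0 \<le> \<nu>"
  shows "3 * \<nu>\<^sup>2 * u - 2 * \<nu>^3 * d \<le> u^3 / d\<^sup>2"
proof -
  have "0 \<le> (u - \<nu> * d)\<^sup>2 * (u + 2 * (\<nu> * d))"
    using assms by simp
  also have "\<dots> = u^3 - (3 * \<nu>\<^sup>2 * u - 2 * \<nu>^3 * d) * d\<^sup>2"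
    by algebra
  finally show ?thesis
    using assms by (simp add: pos_le_divide_eq)
qed

lemma support_form_le_gauge_sq:
  assumes "0 \<le> \<nu>"
  shows "support_form \<nu> x \<le> gauge_sq x"
proof (cases "x = 0")
  case True
  then show ?thesis by (simp add: support_form_def gauge_sq_def z1sq_def)
next
  case False
  have "3 * \<nu>\<^sup>2 * (norm x)\<^sup>2 - 2 * \<nu>^3 * (4 * z1sq x + (norm x)\<^sup>2)
      \<le> (norm x)^6 / (4 * z1sq x + (norm x)\<^sup>2)\<^sup>2"
    unfolding norm_pow6
    by (rule tangent_inequality) (use False assms denominator_pos in auto)
  then show ?thesis
    by (simp add: support_form_def gauge_sq_def algebra_simps)
qed

lemma gauge_sq_eq_support_form:
  assumes "x \<noteq> 0"
  defines "\<nu> \<equiv> (norm x)\<^sup>2 / (4 * z1sq x + (norm x)\<^sup>2)"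
  shows "\<nu> \<in> {0..1}" "gauge_sq x = support_form \<nu> x"
proof -
  define u d where "u = (norm x)\<^sup>2" and "d = 4 * z1sq x + u"
  have d: "0 < d" and \<nu>: "\<nu> = u / d"
    using denominator_pos[OF assms(1)] by (simp_all add: d_def u_def \<nu>_def)
  show "\<nu> \<in> {0..1}"
    using d by (simp add: \<nu>) (simp add: d_def u_def)
  have z: "z1sq x = (d - u) / 4"
    by (simp add: d_def)
  have u: "u = \<nu> * d"
    using d by (simp add: \<nu>)
  have "support_form \<nu> x = u + \<nu>\<^sup>2 * u / 8"
    unfolding support_form_def z u_def[symmetric] unfolding u
    by (simp add: field_simps power2_eq_square power3_eq_cube)
  also have "\<nu>\<^sup>2 * u = u^3 / d\<^sup>2"
    by (simp add: \<nu> power_divide power2_eq_square power3_eq_cube)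
  finally have "support_form \<nu> x = u + u^3 / (8 * d\<^sup>2)"
    by simp
  then show "gauge_sq x = support_form \<nu> x"
    by (simp only: gauge_sq_def norm_pow6 u_def d_def)
qed

text \<open>Being an intersection of ellipsoidal regions, the body is closed and convex, although neither is
apparent from the formula for \<^const>\<open>gauge_sq\<close>.\<close>

lemma body_eq_Inter: "body = (\<Inter>\<nu>\<in>{0..1}. {x. support_form \<nu> x \<le> 1})"
proof (intro equalityI subsetI)
  fix x assume "x \<in> body"
  then show "x \<in> (\<Inter>\<nu>\<in>{0..1}. {x. support_form \<nu> x \<le> 1})"
    using support_form_le_gauge_sq order_trans by (fastforce simp: body_def)
next
  fix x assume *: "x \<in> (\<Inter>\<nu>\<in>{0..1}. {x. support_form \<nu> x \<le> 1})"
  show "x \<in> body"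
  proof (cases "x = 0")
    case True
    then show ?thesis by (simp add: body_def gauge_sq_def)
  next
    case False
    then show ?thesis
      using * gauge_sq_eq_support_form[OF False] by (auto simp: body_def)
  qed
qed

text \<open>The factor \<open>1/8\<close> in \<^const>\<open>gauge_sq\<close> is chosen for this inequality: it makes the negative term
exactly \<open>\<nu>\<^sup>3 |z\<^sub>1|\<^sup>2\<close>, which is dominated by \<open>|x|\<^sup>2\<close>.\<close>

lemma support_form_nonneg:
  assumes "\<nu> \<in> {0..1}"
  shows "0 \<le> support_form \<nu> x"
proof -
  have c: "\<nu>^3 \<le> 1" "\<nu>^3 \<le> \<nu>\<^sup>2"
    using assms by (auto intro: power_le_one power_decreasing)
  have "\<nu>^3 * z1sq x \<le> 1 * (norm x)\<^sup>2"
    using assms c z1sq_le_norm_sq by (intro mult_mono) auto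
  also have "\<dots> \<le> (1 + (3 * \<nu>\<^sup>2 - 2 * \<nu>^3) / 8) * (norm x)\<^sup>2"
  proof (intro mult_right_mono)
    show "1 \<le> 1 + (3 * \<nu>\<^sup>2 - 2 * \<nu>^3) / 8"
    proof -
      have "1 \<le> 1 + (3 * q - 2 * p) / 8" if "p \<le> q" "0 \<le> q" for p q :: real
        using that by simp
      then show ?thesis using c zero_le_power2 by blast
    qed
  qed simp
  finally show ?thesis
    by (simp add: support_form_def)
qed

lemma convex_support_form_sublevel:
  assumes "\<nu> \<in> {0..1}"
  shows "convex {x. support_form \<nu> x \<le> 1}"
proof (rule convexI, clarify)
  fix x y :: "real^6" and s t :: real
  assume le: "support_form \<nu> x \<le> 1" "support_form \<nu> y \<le> 1"
    and st: "0 \<le> s" "0 \<le> t" "s + t = 1"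
  have t: "t = 1 - s" using st by simp
  \<comment> \<open>a quadratic form deviates from affinity on a segment by \<open>- s t\<close> times its value on the difference vector\<close>
  have sq: "(s * p + t * q)\<^sup>2 = s * p\<^sup>2 + t * q\<^sup>2 - s * t * (p - q)\<^sup>2" for p q
    unfolding t by algebra
  have "support_form \<nu> (s *\<^sub>R x + t *\<^sub>R y)
      = s * support_form \<nu> x + t * support_form \<nu> y - s * t * support_form \<nu> (x - y)"
    unfolding support_form_def norm_sq_6 z1sq_def vector_add_component vector_scaleR_component
      vector_minus_component real_scaleR_def sq
    by algebra
  also have "\<dots> \<le> s * 1 + t * 1"
  proof -
    have "0 \<le> s * t * support_form \<nu> (x - y)"
      using support_form_nonneg[OF assms] st by simp
    moreover have "s * support_form \<nu> x \<le> s * 1" "t * support_form \<nu> y \<le> t * 1"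
      using le st by (simp_all only: mult_left_mono)
    ultimately show ?thesis by linarith
  qed
  finally show "support_form \<nu> (s *\<^sub>R x + t *\<^sub>R y) \<le> 1"
    using st by simp
qed

lemma closed_body: "closed body"
  unfolding body_eq_Inter support_form_def z1sq_def
  by (intro closed_INT ballI closed_Collect_le continuous_intros)

lemma norm_sq_less_gauge_sq: "x \<noteq> 0 \<Longrightarrow> (norm x)\<^sup>2 < gauge_sq x"
  using denominator_pos[of x] by (simp add: gauge_sq_def)

lemma gauge_sq_le: "gauge_sq x \<le> 9 / 8 * (norm x)\<^sup>2"
proof (cases "x = 0")
  case True
  then show ?thesis by (simp add: gauge_sq_def)
next
  case False
  have "(norm x)^6 / (8 * (4 * z1sq x + (norm x)\<^sup>2)\<^sup>2) \<le> (norm x)^6 / (8 * ((norm x)\<^sup>2)\<^sup>2)"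
    using False denominator_pos[OF False]
    by (intro divide_left_mono mult_left_mono power_mono mult_pos_pos) auto
  also have "\<dots> = (norm x)\<^sup>2 / 8"
    using False by (simp add: field_simps flip: power_mult power_add)
  finally show ?thesis
    by (simp add: gauge_sq_def)
qed

lemma body_subset_ball: "body \<subseteq> ball 0 1"
proof
  fix x assume "x \<in> body"
  then have "(norm x)\<^sup>2 < 1"
    using norm_sq_less_gauge_sq[of x] by (cases "x = 0") (auto simp: body_def)
  then show "x \<in> ball 0 1"
    by (simp add: power_less_one_iff abs_square_less_1)
qed

lemma convex_body_body: "convex_body body"
  unfolding convex_body_def
proof (intro conjI)
  show "compact body"
    using closed_body body_subset_ball bounded_subset[OF bounded_ball]
    by (auto simp: compact_eq_bounded_closed)
  show "convex body"
    unfolding body_eq_Inter by (intro convex_INT convex_support_form_sublevel)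
  have "ball 0 (1/2) \<subseteq> body"
  proof
    fix x :: "real^6" assume "x \<in> ball 0 (1/2)"
    then have "(norm x)\<^sup>2 \<le> (1/2)\<^sup>2"
      by (intro power_mono) auto
    then show "x \<in> body"
      using gauge_sq_le[of x] by (simp add: body_def power2_eq_square)
  qed
  then show "0 \<in> interior body"
    by (meson centre_in_ball half_gt_zero_iff interior_maximal open_ball subsetD zero_less_one)
qed

text \<open>By homogeneity, \<open>x\<close> lies in the \<open>a\<close>-fold dilate of the sublevel set if and only if \<open>F x \<le> a\<^sup>2\<close>.\<close>

lemma minkowski_sublevel:
  fixes F :: "'a::euclidean_space \<Rightarrow> real"
  assumes hom: "\<And>t x. F (t *\<^sub>R x) = t\<^sup>2 * F x"
    and pos: "\<And>x. x \<noteq> 0 \<Longrightarrow> 0 < F x"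
  shows "minkowski {x. F x \<le> 1} x = sqrt (F x)"
proof -
  have F0: "F 0 = 0" using hom[of 0 0] by simp
  have nn: "0 \<le> F x" for x
    using pos[of x] F0 by (cases "x = 0") auto
  show ?thesis
    unfolding minkowski_def
  proof (rule Least_equality)
    show "0 \<le> sqrt (F x) \<and> x \<in> (\<lambda>y. sqrt (F x) *\<^sub>R y) ` {x. F x \<le> 1}"
    proof (cases "x = 0")
      case True
      then show ?thesis using F0 by (auto intro!: image_eqI[of _ _ 0])
    next
      case False
      then have "x = sqrt (F x) *\<^sub>R ((1 / sqrt (F x)) *\<^sub>R x)"
        using pos[OF False] by simp
      moreover have "F ((1 / sqrt (F x)) *\<^sub>R x) \<le> 1"
        using pos[OF False] by (simp add: hom power_divide)
      ultimately show ?thesis using nn[of x]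
        by (metis (mono_tags, lifting) image_eqI mem_Collect_eq real_sqrt_ge_0_iff)
    qed
  next
    fix a assume a: "0 \<le> a \<and> x \<in> (\<lambda>y. a *\<^sub>R y) ` {x. F x \<le> 1}"
    then obtain y where "x = a *\<^sub>R y" "F y \<le> 1" by auto
    then have "F x \<le> a\<^sup>2"
      using mult_left_mono[of "F y" 1 "a\<^sup>2"] by (simp add: hom)
    then show "sqrt (F x) \<le> a"
      using a real_le_lsqrt by auto
  qed
qed

lemma minkowski_body: "minkowski body x = sqrt (gauge_sq x)"
  unfolding body_def
proof (rule minkowski_sublevel)
  fix t and x :: "real^6"
  have "z1sq (t *\<^sub>R x) = t\<^sup>2 * z1sq x"
    by (simp add: z1sq_def power_mult_distrib distrib_left)
  moreover have "\<bar>t\<bar>^6 = (t\<^sup>2)^3"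
    by (simp flip: power_mult)
  ultimately have "gauge_sq (t *\<^sub>R x)
      = t\<^sup>2 * (norm x)\<^sup>2 + (t\<^sup>2)^3 * (norm x)^6 / (8 * (t\<^sup>2 * (4 * z1sq x + (norm x)\<^sup>2))\<^sup>2)"
    by (simp only: gauge_sq_def norm_scaleR power_mult_distrib power2_abs
        mult.left_commute[of 4] flip: distrib_left)
  also have "\<dots> = t\<^sup>2 * gauge_sq x"
  proof (cases "t = 0")
    case False
    have "T^3 * n / (8 * (T * d)\<^sup>2) = T * (n / (8 * d\<^sup>2))" if "T \<noteq> 0" for T n d :: real
      using that by (simp add: power2_eq_square power3_eq_cube)
    from this[of "t\<^sup>2"] False show ?thesis
      unfolding gauge_sq_def distrib_left[of "t\<^sup>2" "(norm x)\<^sup>2"] by simp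
  qed simp
  finally show "gauge_sq (t *\<^sub>R x) = t\<^sup>2 * gauge_sq x" .
next
  show "0 < gauge_sq x" if "x \<noteq> 0" for x
    using norm_sq_less_gauge_sq[OF that] by (meson le_less_trans zero_le_power2)
qed

lemma rotation_norm_sq:
  fixes c s p q :: real
  assumes "c\<^sup>2 + s\<^sup>2 = 1"
  shows "(c * p - s * q)\<^sup>2 + (s * p + c * q)\<^sup>2 = p\<^sup>2 + q\<^sup>2"
proof -
  have "(c * p - s * q)\<^sup>2 + (s * p + c * q)\<^sup>2 = (c\<^sup>2 + s\<^sup>2) * (p\<^sup>2 + q\<^sup>2)"
    by algebra
  then show ?thesis by (simp add: assms)
qed

lemma R_theta_invariant_body: "R_theta_invariant body"
proof -
  have z: "z1sq (rot \<theta> x) = z1sq x" for \<theta> x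
    by (simp add: z1sq_def rot_nth rotation_norm_sq)
  have "(norm (rot \<theta> x))\<^sup>2 = (norm x)\<^sup>2" for \<theta> x
    using rotation_norm_sq[of "cos \<theta>" "sin \<theta>"] unfolding norm_sq_6 rot_nth
    by (smt (verit) sin_cos_squared_add2)
  then have "norm (rot \<theta> x) = norm x" for \<theta> x
    by simp
  with z show ?thesis
    by (simp add: R_theta_invariant_def minkowski_body gauge_sq_def)
qed

text \<open>The body is designed backwards from this formula: since
\<open>\<parallel>x\<parallel>\<^bsup>-2\<^esup> / (1 - (|x| / \<parallel>x\<parallel>)\<^sup>2) = 1 / (\<parallel>x\<parallel>\<^sup>2 - |x|\<^sup>2)\<close>, any prescribed positive
density that is homogeneous of degree \<open>-2\<close> can be obtained by adding its reciprocal to \<open>|x|\<^sup>2\<close>, as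
long as convexity is preserved.\<close>

lemma distribution_density:
  "minkowski body x powi (-2) / (1 - (norm x / minkowski body x)\<^sup>2)
     = 8 * (4 * z1sq x + (norm x)\<^sup>2)\<^sup>2 / (norm x)^6"
proof (cases "x = 0")
  \<comment> \<open>division by zero makes both sides vanish at the origin\<close>
  case True
  then show ?thesis by (simp add: minkowski_body gauge_sq_def)
next
  case False
  let ?N = "gauge_sq x"
  have N: "0 < ?N" "(norm x)\<^sup>2 < ?N"
    using norm_sq_less_gauge_sq[OF False] by (auto intro: le_less_trans[OF zero_le_power2])
  have "minkowski body x powi (-2) / (1 - (norm x / minkowski body x)\<^sup>2)
      = (1 / ?N) / (1 - (norm x)\<^sup>2 / ?N)"
    using N by (simp add: minkowski_body power_int_minus power_divide inverse_eq_divide)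
  also have "\<dots> = 1 / (?N - (norm x)\<^sup>2)"
    using N by (simp add: field_simps)
  also have "\<dots> = 8 * (4 * z1sq x + (norm x)\<^sup>2)\<^sup>2 / (norm x)^6"
    by (simp add: gauge_sq_def)
  finally show ?thesis .
qed

section \<open>Smoothness\<close>

text \<open>Smoothness of explicit functions, and the shape of all their iterated derivatives, is obtained from
one principle: a set of functions that contains the directional derivatives of its members consists
of smooth functions, and iterated derivatives stay inside it.\<close>

definition closed_under_derivatives ::
    "('a::euclidean_space \<Rightarrow> 'b::real_normed_vector) set \<Rightarrow> bool" where
  "closed_under_derivatives C \<longleftrightarrow>
     (\<forall>f\<in>C. \<exists>f'. (\<forall>x. (f has_derivative f' x) (at x)) \<and> (\<forall>v. (\<lambda>x. f' x v) \<in> C))"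

lemma closed_under_derivatives_frechet:
  assumes "closed_under_derivatives C" "f \<in> C"
  shows "f differentiable (at x)" "(\<lambda>x. frechet_derivative f (at x) v) \<in> C"
proof -
  obtain f' where f': "\<And>x. (f has_derivative f' x) (at x)" "\<And>v. (\<lambda>x. f' x v) \<in> C"
    using assms unfolding closed_under_derivatives_def by blast
  show "f differentiable (at x)"
    using f'(1) differentiableI by blast
  have "frechet_derivative f (at x) = f' x" for x
    using f'(1) frechet_derivative_at by metis
  then show "(\<lambda>x. frechet_derivative f (at x) v) \<in> C"
    using f'(2) by simp
qed

lemma closed_under_derivatives_Ck:
  assumes "closed_under_derivatives C" "f \<in> C"
  shows "Ck_on k UNIV f"
  using assms(2)
proof (induction k arbitrary: f)
  case 0
  then show ?case
    using closed_under_derivatives_frechet(1)[OF assms(1)]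
    by (auto intro: continuous_at_imp_continuous_on differentiable_imp_continuous_within)
next
  case (Suc k)
  then show ?case
    using closed_under_derivatives_frechet[OF assms(1)] by simp
qed

lemma closed_under_derivatives_iterated:
  assumes "closed_under_derivatives C" "f \<in> C"
  shows "iterated_deriv vs f \<in> C"
  using assms by (induction vs) (auto intro: closed_under_derivatives_frechet)

text \<open>Polynomials in the coordinates and in the generators \<open>G\<close>; for empty \<open>G\<close> these are the polynomial
functions.\<close>

inductive_set generated_algebra :: "('a::euclidean_space \<Rightarrow> real) set \<Rightarrow> ('a \<Rightarrow> real) set"
  for G where
  const: "(\<lambda>x. c) \<in> generated_algebra G"
| coordinate: "(\<lambda>x. x \<bullet> b) \<in> generated_algebra G"
| generator: "g \<in> G \<Longrightarrow> g \<in> generated_algebra G"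
| add: "f \<in> generated_algebra G \<Longrightarrow> g \<in> generated_algebra G \<Longrightarrow>
    (\<lambda>x. f x + g x) \<in> generated_algebra G"
| mult: "f \<in> generated_algebra G \<Longrightarrow> g \<in> generated_algebra G \<Longrightarrow>
    (\<lambda>x. f x * g x) \<in> generated_algebra G"

text \<open>By the sum and product rules it suffices to differentiate the generators.\<close>

lemma generated_algebra_closed_under_derivatives:
  assumes "\<And>g. g \<in> G \<Longrightarrow>
    \<exists>g'. (\<forall>x. (g has_derivative g' x) (at x)) \<and> (\<forall>v. (\<lambda>x. g' x v) \<in> generated_algebra G)"
  shows "closed_under_derivatives (generated_algebra G)"
  unfolding closed_under_derivatives_def
proof
  fix f assume "f \<in> generated_algebra G"
  then show "\<exists>f'. (\<forall>x. (f has_derivative f' x) (at x)) \<and>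
      (\<forall>v. (\<lambda>x. f' x v) \<in> generated_algebra G)"
  proof induction
    case (const c)
    then show ?case
      by (intro exI[of _ "\<lambda>x v. 0"]) (auto intro: generated_algebra.const)
  next
    case (coordinate b)
    then show ?case
      by (intro exI[of _ "\<lambda>x v. v \<bullet> b"])
        (auto intro: generated_algebra.const derivative_eq_intros)
  next
    case (generator g)
    then show ?case by (rule assms)
  next
    case (add f g)
    then obtain f' g' where
      "\<And>x. (f has_derivative f' x) (at x)" "\<And>v. (\<lambda>x. f' x v) \<in> generated_algebra G"
      "\<And>x. (g has_derivative g' x) (at x)" "\<And>v. (\<lambda>x. g' x v) \<in> generated_algebra G"
      by blast
    then show ?case
      by (intro exI[of _ "\<lambda>x v. f' x v + g' x v"])
        (auto intro: generated_algebra.add has_derivative_add)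
  next
    case (mult f g)
    then obtain f' g' where
      f': "\<And>x. (f has_derivative f' x) (at x)" "\<And>v. (\<lambda>x. f' x v) \<in> generated_algebra G" and
      g': "\<And>x. (g has_derivative g' x) (at x)" "\<And>v. (\<lambda>x. g' x v) \<in> generated_algebra G"
      by blast
    show ?case
      by (intro exI[of _ "\<lambda>x v. f x * g' x v + f' x v * g x"] conjI allI has_derivative_mult
          generated_algebra.add generated_algebra.mult mult.hyps f' g')
  qed
qed

lemma generated_algebra_component: "(\<lambda>x :: real^'n. x $ i) \<in> generated_algebra G"
  using generated_algebra.coordinate[of "axis i 1"] by (simp add: cart_eq_inner_axis)

text \<open>The Minkowski functional is not differentiable at the origin. Replacing \<open>|x|\<close> by its value 1 on
the sphere yields an extension from the sphere that is smooth on the whole space.\<close>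

definition sphere_gauge :: "real^6 \<Rightarrow> real" where
  "sphere_gauge x = sqrt (1 + (1 / (4 * z1sq x + 1))\<^sup>2 / 8)"

text \<open>With \<open>w = 1 / (4 |z\<^sub>1|\<^sup>2 + 1)\<close>, \<open>h = sqrt (1 + w\<^sup>2 / 8)\<close> and \<open>q = 1 / h\<close>, the derivatives of all three
are polynomials in \<open>w\<close>, \<open>q\<close> and the coordinates. The reciprocal \<open>q\<close> has to be a generator because
the derivative of a square root involves it.\<close>

lemma sphere_gauge_Ck: "Ck_on k UNIV sphere_gauge"
proof -
  define w where "w x = 1 / (4 * z1sq x + 1)" for x
  define h where "h = sphere_gauge"
  define q where "q x = 1 / h x" for x
  define dz where "dz x v = 2 * x$1 * v$1 + 2 * x$2 * v$2" for x v :: "real^6"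
  define A where "A = generated_algebra {w, h, q}"
  have h: "h x = sqrt (1 + (w x)\<^sup>2 / 8)" for x
    by (simp add: h_def sphere_gauge_def w_def)
  have hpos: "0 < 1 + (w x)\<^sup>2 / 8" for x
    by (simp add: add_pos_nonneg)
  have hpos': "0 < h x" for x
    using hpos by (simp add: h)
  have dpos: "0 < 4 * z1sq x + 1" for x
    by (simp add: add_nonneg_pos)
  have comp: "((\<lambda>x. x $ i) has_derivative (\<lambda>v. v $ i)) (at x)" for i and x :: "real^6"
    by (rule bounded_linear_imp_has_derivative) (rule bounded_linear_vec_nth)
  have z': "(z1sq has_derivative dz x) (at x)" for x
    unfolding z1sq_def[abs_def] dz_def[abs_def]
    by (rule derivative_eq_intros comp refl | simp add: ac_simps)+
  have w': "(w has_derivative (\<lambda>v. - 4 * (w x * w x) * dz x v)) (at x)" for x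
    unfolding w_def[abs_def]
    by (rule derivative_eq_intros z' refl | use dpos[of x] in \<open>simp add: field_simps power2_eq_square\<close>)+
  have h': "(h has_derivative (\<lambda>v. 1 / 8 * (w x * q x) * (- 4 * (w x * w x) * dz x v))) (at x)" for x
    unfolding h[abs_def]
    by (rule derivative_eq_intros w' refl hpos | simp add: q_def h field_simps)+
  have q': "(q has_derivative
      (\<lambda>v. - 1 * (q x * q x) * (1 / 8 * (w x * q x) * (- 4 * (w x * w x) * dz x v)))) (at x)" for x
    unfolding q_def[abs_def]
    by (rule derivative_eq_intros h' refl | use hpos'[of x] in \<open>simp add: q_def field_simps\<close>)+
  have A: "w \<in> A" "h \<in> A" "q \<in> A" "(\<lambda>x. dz x v) \<in> A" "(\<lambda>x. c) \<in> A" for v c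
    unfolding A_def dz_def
    by (intro generated_algebra.intros generated_algebra_component; simp)+
  have mult: "f \<in> A \<Longrightarrow> g \<in> A \<Longrightarrow> (\<lambda>x. f x * g x) \<in> A" for f g
    unfolding A_def by (rule generated_algebra.mult)
  have "closed_under_derivatives A"
    unfolding A_def
  proof (rule generated_algebra_closed_under_derivatives, unfold A_def[symmetric])
    fix g assume "g \<in> {w, h, q}"
    then consider "g = w" | "g = h" | "g = q" by blast
    then show "\<exists>g'. (\<forall>x. (g has_derivative g' x) (at x)) \<and> (\<forall>v. (\<lambda>x. g' x v) \<in> A)"
    proof cases
      case 1
      show ?thesis
        unfolding 1 by (intro exI conjI allI) (rule w', intro mult A)
    next
      case 2
      show ?thesis
        unfolding 2 by (intro exI conjI allI) (rule h', intro mult A)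
    next
      case 3
      show ?thesis
        unfolding 3 by (intro exI conjI allI) (rule q', intro mult A)
    qed
  qed
  with A(2) show ?thesis
    unfolding h_def by (rule closed_under_derivatives_Ck[rotated])
qed

lemma infinitely_smooth_body: "infinitely_smooth body"
  unfolding infinitely_smooth_def Ck_on_subset_def
proof (intro allI ballI exI conjI)
  fix k and x :: "real^6"
  show "Ck_on k UNIV sphere_gauge" by (rule sphere_gauge_Ck)
  show "sphere_gauge y = minkowski body y" if "y \<in> UNIV \<inter> sphere 0 1" for y
    using that by (simp add: minkowski_body sphere_gauge_def gauge_sq_def power_divide)
qed auto

section \<open>The test function\<close>

text \<open>The Gaussian has width chosen such that the autocorrelation of the test function carries the factor
\<open>exp (- |x|\<^sup>2)\<close>. The linear factor of the test function makes the Fourier transform of the autocorrelation vanish to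
second order at the origin, so the autocorrelation has to take negative values.\<close>

definition test_function :: "real^6 \<Rightarrow> complex" where
  "test_function x = complex_of_real (x$1 * exp (- 2 * (norm x)\<^sup>2))"

definition gaussian_multiples :: "('a::euclidean_space \<Rightarrow> complex) set" where
  "gaussian_multiples =
     {\<lambda>x. complex_of_real (p x * exp (- 2 * (norm x)\<^sup>2)) | p. p \<in> generated_algebra {}}"

lemma gaussian_multiples_closed_under_derivatives:
  "closed_under_derivatives (gaussian_multiples :: ('a::euclidean_space \<Rightarrow> complex) set)"
  unfolding closed_under_derivatives_def
proof
  fix f :: "'a \<Rightarrow> complex" assume "f \<in> gaussian_multiples"
  then obtain p where p: "p \<in> generated_algebra {}"
    and f: "f = (\<lambda>x. complex_of_real (p x * exp (- 2 * (norm x)\<^sup>2)))"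
    by (auto simp: gaussian_multiples_def)
  have "closed_under_derivatives (generated_algebra ({} :: ('a \<Rightarrow> real) set))"
    by (rule generated_algebra_closed_under_derivatives) simp
  with p obtain p' where p': "\<And>x. (p has_derivative p' x) (at x)"
      "\<And>v. (\<lambda>x. p' x v) \<in> generated_algebra {}"
    unfolding closed_under_derivatives_def by blast
  define d where "d x v = p' x v + - 4 * (p x * (x \<bullet> v))" for x v
  have d_in: "(\<lambda>x. d x v) \<in> generated_algebra {}" for v
    unfolding d_def by (intro generated_algebra.intros p p')
  have "((\<lambda>x. p x * exp (- 2 * (x \<bullet> x))) has_derivative
      (\<lambda>v. d x v * exp (- 2 * (x \<bullet> x)))) (at x)" for x
    by (rule derivative_eq_intros p' refl |
        simp add: d_def fun_eq_iff algebra_simps inner_commute)+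
  then have "(f has_derivative (\<lambda>v. complex_of_real (d x v * exp (- 2 * (norm x)\<^sup>2)))) (at x)" for x
    unfolding f power2_norm_eq_inner by (rule has_derivative_of_real)
  with d_in show "\<exists>f'. (\<forall>x. (f has_derivative f' x) (at x)) \<and>
      (\<forall>v. (\<lambda>x. f' x v) \<in> gaussian_multiples)"
    by (intro exI[of _ "\<lambda>x v. complex_of_real (d x v * exp (- 2 * (norm x)\<^sup>2))"])
      (auto simp: gaussian_multiples_def)
qed

lemma polynomial_growth:
  assumes "p \<in> generated_algebra {}"
  shows "\<exists>C n. \<forall>x. \<bar>p x\<bar> \<le> C * (1 + norm x)^n"
  using assms
proof induction
  case (const c)
  then show ?case by (intro exI[of _ "\<bar>c\<bar>"] exI[of _ 0]) simp
next
  case (coordinate b)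
  have "\<bar>x \<bullet> b\<bar> \<le> norm b * (1 + norm x)^1" for x
    using Cauchy_Schwarz_ineq2[of x b] norm_ge_zero[of b] by (simp add: algebra_simps del: norm_ge_zero)
  then show ?case by blast
next
  case (generator g)
  then show ?case by simp
next
  case (add f g)
  then obtain C n D m where b: "\<And>x. \<bar>f x\<bar> \<le> C * (1 + norm x)^n" "\<And>x. \<bar>g x\<bar> \<le> D * (1 + norm x)^m"
    by blast
  have nn: "0 \<le> C" "0 \<le> D"
    using b[of 0] by (auto intro: order_trans[OF abs_ge_zero])
  have "\<bar>f x + g x\<bar> \<le> (C + D) * (1 + norm x)^(n + m)" for x
  proof -
    have "\<bar>f x + g x\<bar> \<le> C * (1 + norm x)^n + D * (1 + norm x)^m"
      using b[of x] by linarith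
    also have "\<dots> \<le> C * (1 + norm x)^(n + m) + D * (1 + norm x)^(n + m)"
      using nn by (intro add_mono mult_left_mono power_increasing) auto
    finally show ?thesis by (simp add: distrib_right)
  qed
  then show ?case by blast
next
  case (mult f g)
  then obtain C n D m where b: "\<And>x. \<bar>f x\<bar> \<le> C * (1 + norm x)^n" "\<And>x. \<bar>g x\<bar> \<le> D * (1 + norm x)^m"
    by blast
  have "\<bar>f x * g x\<bar> \<le> (C * D) * (1 + norm x)^(n + m)" for x
    using mult_mono'[OF b[of x] abs_ge_zero abs_ge_zero]
    by (simp add: abs_mult power_add ac_simps)
  then show ?case by blast
qed

lemma power_le_fact_mult_exp:
  fixes t :: real
  assumes "0 \<le> t"
  shows "t^n \<le> fact n * exp t"
proof -
  have "(\<Sum>k\<in>{n}. t^k /\<^sub>R fact k) \<le> (\<Sum>k. t^k /\<^sub>R fact k)"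
    using assms exp_converges[of t] by (intro sum_le_suminf) (auto simp: sums_iff)
  then show ?thesis
    using exp_converges[of t] by (simp add: sums_iff field_simps)
qed

lemma gaussian_beats_power: "(1 + t)^n * exp (- 2 * t\<^sup>2) \<le> fact n * exp (2 :: real)" if "0 \<le> t"
proof -
  have "(1 + t)^n * exp (- 2 * t\<^sup>2) \<le> fact n * exp (1 + t) * exp (- 2 * t\<^sup>2)"
    using that by (intro mult_right_mono power_le_fact_mult_exp) auto
  also have "\<dots> = fact n * exp (1 + t - 2 * t\<^sup>2)"
    by (simp flip: exp_add)
  also have "1 + t - 2 * t\<^sup>2 = 2 - ((t - 1)\<^sup>2 + 3 * t\<^sup>2 + 1) / 2"
    by (simp add: power2_eq_square field_simps)
  then have "1 + t - 2 * t\<^sup>2 \<le> 2"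
    by simp
  then have "fact n * exp (1 + t - 2 * t\<^sup>2) \<le> fact n * exp (2 :: real)"
    by simp
  finally show ?thesis .
qed

lemma schwartz_test_function: "schwartz test_function"
  unfolding schwartz_def
proof (intro conjI allI impI)
  have mem: "test_function \<in> gaussian_multiples"
    unfolding gaussian_multiples_def test_function_def[abs_def]
    by (intro CollectI exI[of _ "\<lambda>x. x $ 1"] conjI refl generated_algebra_component)
  note closed = gaussian_multiples_closed_under_derivatives
  show "Ck_on k UNIV test_function" for k
    by (rule closed_under_derivatives_Ck[OF closed mem])
  fix N and vs :: "(real^6) list"
  from closed_under_derivatives_iterated[OF closed mem, of vs]
  obtain p where p: "p \<in> generated_algebra {}"
    and D: "\<And>x. iterated_deriv vs test_function x = complex_of_real (p x * exp (- 2 * (norm x)\<^sup>2))"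
    by (auto simp: gaussian_multiples_def)
  obtain C n where C: "\<And>x. \<bar>p x\<bar> \<le> C * (1 + norm x)^n"
    using polynomial_growth[OF p] by blast
  have "0 \<le> C"
    using C[of 0] by (auto intro: order_trans[OF abs_ge_zero])
  have "norm x^N * norm (iterated_deriv vs test_function x) \<le> C * (fact (N + n) * exp 2)" for x
  proof -
    have "norm x^N * norm (iterated_deriv vs test_function x)
        = norm x^N * (\<bar>p x\<bar> * exp (- 2 * (norm x)\<^sup>2))"
      by (simp add: D norm_mult)
    also have "\<dots> \<le> (1 + norm x)^N * ((C * (1 + norm x)^n) * exp (- 2 * (norm x)\<^sup>2))"
      using C \<open>0 \<le> C\<close> by (intro mult_mono power_mono) auto
    also have "\<dots> = C * ((1 + norm x)^(N + n) * exp (- 2 * (norm x)\<^sup>2))"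
      by (simp add: power_add)
    also have "\<dots> \<le> C * (fact (N + n) * exp 2)"
      using \<open>0 \<le> C\<close> by (intro mult_left_mono gaussian_beats_power) auto
    finally show ?thesis .
  qed
  then show "\<exists>C. \<forall>x. norm x^N * norm (iterated_deriv vs test_function x) \<le> C"
    by blast
qed

section \<open>Gaussian integrals\<close>

text \<open>The moment of order \<open>2 k\<close> of the probability measure on the line with density proportional to
\<open>exp (- l y\<^sup>2)\<close>.\<close>

definition gaussian_moment :: "real \<Rightarrow> nat \<Rightarrow> real" where
  "gaussian_moment l k = fact (2 * k) / (fact k * (4 * l)^k)"

lemma gaussian_moment_small:
  "gaussian_moment l 0 = 1"
  "gaussian_moment l 1 = 1 / 2 * (1 / l)"
  "gaussian_moment l 2 = 3 / 4 * (1 / l)\<^sup>2"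
  "gaussian_moment l 3 = 15 / 8 * (1 / l)^3"
  by (simp_all add: gaussian_moment_def fact_numeral power_mult_distrib power_divide)

lemma has_bochner_integral_even_power_gaussian:
  assumes "0 < l"
  shows "has_bochner_integral lborel (\<lambda>x :: real. x^(2 * k) * exp (- l * x\<^sup>2))
     (sqrt (pi / l) * gaussian_moment l k)"
proof -
  have "has_bochner_integral lborel (\<lambda>x :: real. exp (- x\<^sup>2) * x^(2 * k))
      (sqrt pi * (fact (2 * k) / (2 ^ (2 * k) * fact k)))"
    using has_bochner_integral_even_function[OF gaussian_moment_even_pos[where k = k]] by simp
  then have "has_bochner_integral lborel
      (\<lambda>x. exp (- (0 + sqrt l * x)\<^sup>2) * (0 + sqrt l * x)^(2 * k))
      ((sqrt pi * (fact (2 * k) / (2 ^ (2 * k) * fact k))) /\<^sub>R \<bar>sqrt l\<bar>)"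
    using assms by (subst (asm) lborel_has_bochner_integral_real_affine_iff[where c = "sqrt l" and t = 0]) auto
  then have "has_bochner_integral lborel (\<lambda>x. 1 / l^k * (exp (- (sqrt l * x)\<^sup>2) * (sqrt l * x)^(2 * k)))
      (1 / l^k * ((sqrt pi * (fact (2 * k) / (2 ^ (2 * k) * fact k))) /\<^sub>R sqrt l))"
    using assms by (intro has_bochner_integral_mult_right) simp
  moreover have "(sqrt l)^(2 * k) = l^k"
    using assms by (simp add: power_mult)
  moreover have "(2::real)^(2 * k) = 4^k"
    by (simp add: power_mult)
  ultimately show ?thesis
    using assms
    by (simp add: power_mult_distrib gaussian_moment_def real_sqrt_divide field_simps)
qed

lemma inj_axis: "inj (\<lambda>i. axis i (1::real))"
  by (simp add: inj_on_def axis_eq_axis)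

lemma prod_Basis_6: "(\<Prod>b\<in>(Basis :: (real^6) set). F b)
   = F (axis 1 1) * F (axis 2 1) * F (axis 3 1) * F (axis 4 1) * F (axis 5 1) * F (axis 6 1)"
proof -
  have B: "(Basis :: (real^6) set) = (\<lambda>i. axis i 1) ` UNIV"
    by (auto simp: Basis_vec_def)
  have "(\<Prod>b\<in>(Basis :: (real^6) set). F b) = (\<Prod>i\<in>UNIV. F (axis i 1))"
    unfolding B by (subst prod.reindex[OF inj_axis]) (simp add: o_def)
  then show ?thesis
    unfolding UNIV_6 by (simp add: ac_simps)
qed

text \<open>The integrand is a product of functions of one coordinate each. Even exponents make it non-negative,
so that the integral factorises before integrability is known.\<close>

lemma has_bochner_integral_gaussian_monomial:
  assumes l: "0 < l"
  shows "has_bochner_integral lborel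
     (\<lambda>x :: real^6. (x$1)^(2 * i) * (x$2)^(2 * j) * exp (- l * (norm x)\<^sup>2))
     ((pi / l)^3 * (gaussian_moment l i * gaussian_moment l j))"
proof (rule has_bochner_integral_nn_integral)
  let ?e = "\<lambda>b :: real^6. if b = axis 1 1 then i else if b = axis 2 1 then j else 0"
  let ?f = "\<lambda>b (y::real). y^(2 * ?e b) * exp (- l * y\<^sup>2)"
  have one: "(\<integral>\<^sup>+y. ennreal (y^(2 * k) * exp (- l * y\<^sup>2)) \<partial>lborel)
      = ennreal (sqrt (pi / l) * gaussian_moment l k)" for k
    using has_bochner_integral_even_power_gaussian[OF l, of k]
    by (subst nn_integral_eq_integral) (auto simp: has_bochner_integral_iff)
  have "ennreal ((x$1)^(2 * i) * (x$2)^(2 * j) * exp (- l * (norm x)\<^sup>2))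
      = (\<Prod>b\<in>Basis. ennreal (?f b (x \<bullet> b)))" for x :: "real^6"
    unfolding prod_ennreal[OF mult_nonneg_nonneg[OF zero_le_even_power'  exp_ge_zero]]
    by (simp add: prod_Basis_6 axis_eq_axis norm_sq_6 cart_eq_inner_axis[symmetric] algebra_simps exp_add exp_diff
        exp_minus inverse_eq_divide)
  then have "(\<integral>\<^sup>+x. ennreal (((x :: real^6)$1)^(2 * i) * (x$2)^(2 * j) * exp (- l * (norm x)\<^sup>2)) \<partial>lborel)
      = (\<integral>\<^sup>+x. (\<Prod>b\<in>Basis. ennreal (?f b ((x :: real^6) \<bullet> b))) \<partial>lborel)"
    by simp
  also have "\<dots> = (\<Prod>b\<in>(Basis :: (real^6) set). \<integral>\<^sup>+y. ennreal (?f b y) \<partial>lborel)"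
    by (rule nn_integral_lborel_prod) auto
  also have "\<dots> = ennreal (\<Prod>b\<in>(Basis :: (real^6) set). sqrt (pi / l) * gaussian_moment l (?e b))"
    unfolding one using l by (intro prod_ennreal) (auto simp: gaussian_moment_def)
  also have "(\<Prod>b\<in>(Basis :: (real^6) set). r * gaussian_moment l (?e b))
      = r^6 * (gaussian_moment l i * gaussian_moment l j)" for r
    by (simp add: prod_Basis_6 axis_eq_axis gaussian_moment_small eval_nat_numeral)
  also have "sqrt (pi / l)^6 = (sqrt (pi / l)^2)^3"
    by (simp flip: power_mult)
  also have "\<dots> = (pi / l)^3"
    using l by simp
  finally show "(\<integral>\<^sup>+x. ennreal ((x$1)^(2 * i) * (x$2)^(2 * j) * exp (- l * (norm x)\<^sup>2)) \<partial>(lborel :: (real^6) measure))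
      = ennreal ((pi / l)^3 * (gaussian_moment l i * gaussian_moment l j))" .
qed (use l in \<open>auto simp: gaussian_moment_def\<close>)

lemma test_function_borel [measurable]: "test_function \<in> borel_measurable borel"
  unfolding test_function_def[abs_def] by measurable

text \<open>After the shift \<open>y \<mapsto> x / 2 + y\<close> the two Gaussians multiply to \<open>exp (- |x|\<^sup>2 - 4 |y|\<^sup>2)\<close> and the two
linear factors to \<open>y\<^sub>1\<^sup>2 - x\<^sub>1\<^sup>2 / 4\<close>, so the convolution is the sum of two Gaussian moments.\<close>

lemma convolution_test_function:
  "Defs.convolution test_function (\<lambda>x. cnj (test_function (- x))) x
     = complex_of_real ((pi / 4)^3 / 8 * ((1 - 2 * (x$1)\<^sup>2) * exp (- (norm x)\<^sup>2)))"
proof -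
  let ?c = "(1 / 2) *\<^sub>R x"
  have [measurable]: "cnj \<in> borel_measurable borel"
    by (intro borel_measurable_continuous_onI continuous_intros)
  define k where "k y = (y$1)\<^sup>2 * exp (- 4 * (norm y)\<^sup>2) - (x$1)\<^sup>2 / 4 * exp (- 4 * (norm y)\<^sup>2)"
    for y :: "real^6"
  have k: "has_bochner_integral lborel k ((pi / 4)^3 / 8 * (1 - 2 * (x$1)\<^sup>2))"
  proof -
    have "has_bochner_integral lborel k
        ((pi / 4)^3 * (gaussian_moment 4 1 * gaussian_moment 4 0)
          - (x$1)\<^sup>2 / 4 * ((pi / 4)^3 * (gaussian_moment 4 0 * gaussian_moment 4 0)))"
      (is "has_bochner_integral _ _ ?v")
      using has_bochner_integral_gaussian_monomial[of 4 1 0] has_bochner_integral_gaussian_monomial[of 4 0 0]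
      unfolding k_def[abs_def]
      by (intro has_bochner_integral_diff has_bochner_integral_mult_right) simp_all
    also have "?v = (pi / 4)^3 / 8 * (1 - 2 * (x$1)\<^sup>2)"
      unfolding gaussian_moment_small by (simp add: field_simps)
    finally show ?thesis .
  qed
  have shift: "test_function (?c + y) * cnj (test_function (- (x - (?c + y))))
      = complex_of_real (exp (- (norm x)\<^sup>2) * k y)" for y
  proof -
    have "(norm (?c + y))\<^sup>2 + (norm (y - ?c))\<^sup>2 = (norm x)\<^sup>2 / 2 + 2 * (norm y)\<^sup>2"
      unfolding power2_norm_eq_inner by (simp add: inner_simps inner_commute field_simps)
    then have e: "exp (- 2 * (norm (?c + y))\<^sup>2) * exp (- 2 * (norm (y - ?c))\<^sup>2)
        = exp (- (norm x)\<^sup>2) * exp (- 4 * (norm y)\<^sup>2)"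
      unfolding exp_add[symmetric] by (intro arg_cong[of _ _ exp]) linarith
    have m: "- (x - (?c + y)) = y - ?c"
      by (simp add: algebra_simps flip: scaleR_add_left)
    have "test_function (?c + y) * cnj (test_function (- (x - (?c + y))))
        = complex_of_real ((?c + y)$1 * (y - ?c)$1 *
            (exp (- 2 * (norm (?c + y))\<^sup>2) * exp (- 2 * (norm (y - ?c))\<^sup>2)))"
      unfolding m by (simp add: test_function_def)
    also have "\<dots> = complex_of_real (exp (- (norm x)\<^sup>2) * k y)"
      unfolding e by (simp add: k_def field_simps power2_eq_square)
    finally show ?thesis .
  qed
  have "Defs.convolution test_function (\<lambda>x. cnj (test_function (- x))) x
      = (LINT y|distr lborel borel ((+) ?c). test_function y * cnj (test_function (- (x - y))))"
    unfolding Defs.convolution_def lborel_distr_plus ..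
  also have "\<dots> = (LINT y|lborel. test_function (?c + y) * cnj (test_function (- (x - (?c + y)))))"
    by (intro integral_distr) measurable
  also have "\<dots> = complex_of_real (exp (- (norm x)\<^sup>2) * (LINT y|lborel. k y))"
    unfolding shift by (simp only: integral_complex_of_real integral_mult_right_zero)
  also have "(LINT y|lborel. k y) = (pi / 4)^3 / 8 * (1 - 2 * (x$1)\<^sup>2)"
    using k by (rule has_bochner_integral_integral_eq)
  finally show ?thesis
    by (simp add: ac_simps)
qed

section \<open>The density as a superposition of Gaussians\<close>

text \<open>The rational density becomes accessible to Gaussian integration through the Laplace transform
\<open>8 (4 a + u)\<^sup>2 / u\<^sup>3 = \<integral> laplace_density t a * exp (- t u) dt\<close> over \<open>t \<ge> 0\<close>, where
\<open>a = |z\<^sub>1|\<^sup>2\<close> and \<open>u = |x|\<^sup>2\<close>: for fixed \<open>t\<close> the integrand is a polynomial times a Gaussian.\<close>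

definition laplace_density :: "real \<Rightarrow> real \<Rightarrow> real" where
  "laplace_density t a = 8 * (8 * a\<^sup>2 * t\<^sup>2 + 8 * a * t + 1)"

lemma laplace_representation:
  fixes u a :: real
  assumes "0 < u" "0 \<le> a"
  shows "(\<integral>\<^sup>+t. ennreal (laplace_density t a * exp (- t * u)) * indicator {0..} t \<partial>lborel)
     = ennreal (8 * (4 * a + u)\<^sup>2 / u^3)"
proof -
  define F where "F t = - 8 * exp (- t * u) *
      (8 * a\<^sup>2 * (t\<^sup>2 / u + 2 * t / u\<^sup>2 + 2 / u^3) + 8 * a * (t / u + 1 / u\<^sup>2) + 1 / u)" for t
  have "(\<integral>\<^sup>+t. ennreal (laplace_density t a * exp (- t * u)) * indicator {0..} t \<partial>lborel)
      = ennreal (0 - F 0)"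
  proof (rule nn_integral_FTC_atLeast)
    show "DERIV F t :> laplace_density t a * exp (- t * u)" for t
      unfolding F_def[abs_def] laplace_density_def
      by (rule derivative_eq_intros refl | (use assms in \<open>simp add: field_simps power2_eq_square power3_eq_cube\<close>))+
    show "(F \<longlongrightarrow> 0) at_top"
      unfolding F_def[abs_def] using assms(1) by real_asymp
    show "(\<lambda>t. laplace_density t a * exp (- t * u)) \<in> borel_measurable borel"
      unfolding laplace_density_def by measurable
  qed (use assms in \<open>auto simp: laplace_density_def\<close>)
  also have "0 - F 0 = 8 * (4 * a + u)\<^sup>2 / u^3"
    using assms by (simp add: F_def field_simps power2_eq_square power3_eq_cube)
  finally show ?thesis .
qed

text \<open>For a non-negative weight \<open>W\<close>, Tonelli's theorem allows integrating over the space first. The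
Gaussian factor then has exponent \<open>t + 1\<close>, and the remaining integral over \<open>t\<close> is read off from a
primitive \<open>F\<close>.\<close>

lemma laplace_weighted_integral:
  fixes W :: "real^6 \<Rightarrow> real" and I :: "real \<Rightarrow> real"
  assumes [measurable]: "W \<in> borel_measurable borel" and W: "\<And>x. 0 \<le> W x"
    and I: "\<And>t. 0 \<le> t \<Longrightarrow> has_bochner_integral lborel
        (\<lambda>x. laplace_density t (z1sq x) * W x * exp (- (t + 1) * (norm x)\<^sup>2)) (I t)"
    and [measurable]: "I \<in> borel_measurable borel"
    and F: "\<And>t. 0 \<le> t \<Longrightarrow> DERIV F t :> I t" "(F \<longlongrightarrow> L) at_top"
  shows "has_bochner_integral lborel
    (\<lambda>x. 8 * (4 * z1sq x + (norm x)\<^sup>2)\<^sup>2 / (norm x)^6 * (W x * exp (- (norm x)\<^sup>2))) (L - F 0)"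
proof -
  let ?g = "\<lambda>t x. ennreal (laplace_density t (z1sq x) * W x * exp (- (t + 1) * (norm x)\<^sup>2)) * indicator {0..} t"
  let ?f = "\<lambda>x. 8 * (4 * z1sq x + (norm x)\<^sup>2)\<^sup>2 / (norm x)^6 * (W x * exp (- (norm x)\<^sup>2))"
  have [measurable]: "z1sq \<in> borel_measurable borel"
    unfolding z1sq_def[abs_def] by measurable
  have ld: "0 \<le> laplace_density t (z1sq x)" if "0 \<le> t" for t x
    using that by (simp add: laplace_density_def)
  have I0: "0 \<le> I t" if "0 \<le> t" for t
    unfolding has_bochner_integral_integral_eq[OF I[OF that], symmetric]
    by (intro Bochner_Integration.integral_nonneg mult_nonneg_nonneg ld that W exp_ge_zero)
  have "(\<integral>\<^sup>+x. ennreal (?f x) \<partial>lborel) = (\<integral>\<^sup>+x. (\<integral>\<^sup>+t. ?g t x \<partial>lborel) \<partial>lborel)"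
  proof (rule nn_integral_cong_AE)
    show "AE x in lborel. ennreal (?f x) = (\<integral>\<^sup>+t. ?g t x \<partial>lborel)"
      \<comment> \<open>the Laplace representation is not available at the origin\<close>
      using AE_lborel_singleton[of 0]
    proof eventually_elim
      case (elim x)
      let ?w = "W x * exp (- (norm x)\<^sup>2)"
      have "ennreal (?f x) = ennreal (8 * (4 * z1sq x + (norm x)\<^sup>2)\<^sup>2 / ((norm x)\<^sup>2)^3) * ennreal ?w"
        unfolding norm_pow6 using W[of x] by (intro ennreal_mult) auto
      also have "ennreal (8 * (4 * z1sq x + (norm x)\<^sup>2)\<^sup>2 / ((norm x)\<^sup>2)^3)
          = (\<integral>\<^sup>+t. ennreal (laplace_density t (z1sq x) * exp (- t * (norm x)\<^sup>2)) * indicator {0..} t \<partial>lborel)"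
        using elim by (intro laplace_representation[symmetric]) auto
      also have "\<dots> * ennreal ?w = (\<integral>\<^sup>+t.
          ennreal (laplace_density t (z1sq x) * exp (- t * (norm x)\<^sup>2)) * indicator {0..} t * ennreal ?w \<partial>lborel)"
        unfolding laplace_density_def by (intro nn_integral_multc[symmetric]) measurable
      also have "\<dots> = (\<integral>\<^sup>+t. ?g t x \<partial>lborel)"
      proof (rule nn_integral_cong)
        fix t :: real
        have "exp (- (t + 1) * (norm x)\<^sup>2) = exp (- t * (norm x)\<^sup>2) * exp (- (norm x)\<^sup>2)"
          unfolding exp_add[symmetric] by (simp add: algebra_simps)
        then have "laplace_density t (z1sq x) * W x * exp (- (t + 1) * (norm x)\<^sup>2)
            = (laplace_density t (z1sq x) * exp (- t * (norm x)\<^sup>2)) * ?w"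
          by (simp only: ac_simps)
        moreover have "ennreal (\<dots>)
            = ennreal (laplace_density t (z1sq x) * exp (- t * (norm x)\<^sup>2)) * ennreal ?w" if "0 \<le> t"
          using W[of x] ld[OF that, of x] by (intro ennreal_mult) auto
        ultimately show "ennreal (laplace_density t (z1sq x) * exp (- t * (norm x)\<^sup>2)) * indicator {0..} t * ennreal ?w
            = ?g t x"
          by (cases "0 \<le> t") (simp_all only: indicator_simps atLeast_iff mult_1_right mult_zero_right
              mult_zero_left not_False_eq_True)
      qed
      finally show ?case .
    qed
  qed
  also have "\<dots> = (\<integral>\<^sup>+t. (\<integral>\<^sup>+x. ?g t x \<partial>lborel) \<partial>lborel)"
    unfolding laplace_density_def by (rule lborel_pair.Fubini') measurable
  also have "\<dots> = (\<integral>\<^sup>+t. ennreal (I t) * indicator {0..} t \<partial>lborel)"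
  proof (rule nn_integral_cong)
    fix t :: real
    show "(\<integral>\<^sup>+x. ?g t x \<partial>lborel) = ennreal (I t) * indicator {0..} t"
    proof (cases "0 \<le> t")
      case True
      then have "(\<integral>\<^sup>+x. ennreal (laplace_density t (z1sq x) * W x * exp (- (t + 1) * (norm x)\<^sup>2)) \<partial>lborel)
          = ennreal (I t)"
        using I[OF True] ld[OF True] W
        by (subst nn_integral_eq_integral) (auto simp: has_bochner_integral_iff)
      with True show ?thesis by simp
    qed simp
  qed
  also have "\<dots> = ennreal (L - F 0)"
    using F I0 by (intro nn_integral_FTC_atLeast) auto
  finally have nn: "(\<integral>\<^sup>+x. ennreal (?f x) \<partial>lborel) = ennreal (L - F 0)" .
  have "0 \<le> L - F 0"
  proof -
    have "F 0 \<le> F t" if "0 \<le> t" for t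
      using that
    proof (rule DERIV_nonneg_imp_nondecreasing)
      show "\<exists>y. DERIV F x :> y \<and> 0 \<le> y" if "0 \<le> x" for x
        using F(1)[OF that] I0[OF that] by blast
    qed
    then have "F 0 \<le> L"
      using F(2) by (intro tendsto_lowerbound[OF F(2)]) (auto intro: eventually_at_top_linorderI)
    then show ?thesis by simp
  qed
  with nn show ?thesis
    using W by (intro has_bochner_integral_nn_integral) auto
qed

section \<open>Failure of positive definiteness\<close>

text \<open>The two terms \<open>1\<close> and \<open>2 x\<^sub>1\<^sup>2\<close> of the factor \<open>1 - 2 x\<^sub>1\<^sup>2\<close> of the
autocorrelation are treated separately, since the Laplace argument is for non-negative weights.
In both cases the primitive is found by expanding the rational function of \<open>t\<close> in powers of
\<open>s = 1 / (t + 1)\<close>, using \<open>t s = 1 - s\<close>.\<close>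

lemma integral_against_gaussian:
  "has_bochner_integral lborel
    (\<lambda>x. 8 * (4 * z1sq x + (norm x)\<^sup>2)\<^sup>2 / (norm x)^6 * (1 * exp (- (norm x)\<^sup>2))) (76 / 3 * pi^3)"
proof -
  define I where "I t = 8 * (pi / (t + 1))^3 *
    (16 * t\<^sup>2 * (1 / (t + 1))\<^sup>2 + 8 * t * (1 / (t + 1)) + 1)" for t :: real
  define F where "F t = 8 * pi^3 / 6 *
    (- 75 * (1 / (t + 1))\<^sup>2 + 80 * (1 / (t + 1))^3 - 24 * (1 / (t + 1))^4)" for t :: real
  have "has_bochner_integral lborel
    (\<lambda>x. 8 * (4 * z1sq x + (norm x)\<^sup>2)\<^sup>2 / (norm x)^6 * (1 * exp (- (norm x)\<^sup>2))) (0 - F 0)"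
  proof (rule laplace_weighted_integral)
    fix t :: real assume t: "0 \<le> t"
    then have l: "0 < t + 1" by simp
    note G = has_bochner_integral_gaussian_monomial[OF l]
    let ?M = "\<lambda>i j. (pi / (t + 1))^3 * (gaussian_moment (t + 1) i * gaussian_moment (t + 1) j)"
    \<comment> \<open>the exponents stay in the form \<open>2 * k\<close>, as in the formula for the moments\<close>
    have exponents: "2 * 0 = (0::nat)" "2 * 1 = (2::nat)" "2 * 2 = (4::nat)" "2 * 3 = (6::nat)"
      by simp_all
    have expand: "8 * (8 * (a\<^sup>2 + b\<^sup>2)\<^sup>2 * t\<^sup>2 + 8 * (a\<^sup>2 + b\<^sup>2) * t + 1) * 1 * e
        = 64 * t\<^sup>2 * (a^(2*2) * b^(2*0) * e) + 128 * t\<^sup>2 * (a^(2*1) * b^(2*1) * e) +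
          64 * t\<^sup>2 * (a^(2*0) * b^(2*2) * e) + 64 * t * (a^(2*1) * b^(2*0) * e) +
          64 * t * (a^(2*0) * b^(2*1) * e) + 8 * (a^(2*0) * b^(2*0) * e)" for a b e :: real
      unfolding exponents power_0 by algebra
    have poly: "64 * t\<^sup>2 * (p * (3 / 4 * s\<^sup>2 * 1)) + 128 * t\<^sup>2 * (p * (1 / 2 * s * (1 / 2 * s)))
        + 64 * t\<^sup>2 * (p * (1 * (3 / 4 * s\<^sup>2))) + 64 * t * (p * (1 / 2 * s * 1))
        + 64 * t * (p * (1 * (1 / 2 * s))) + 8 * (p * (1 * 1))
        = 8 * p * (16 * t\<^sup>2 * s\<^sup>2 + 8 * t * s + 1)" for p s :: real
      by (simp add: algebra_simps power2_eq_square)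
    have "has_bochner_integral lborel
      (\<lambda>x :: real^6. 64 * t\<^sup>2 * ((x$1)^(2*2) * (x$2)^(2*0) * exp (- (t + 1) * (norm x)\<^sup>2)) +
        128 * t\<^sup>2 * ((x$1)^(2*1) * (x$2)^(2*1) * exp (- (t + 1) * (norm x)\<^sup>2)) +
        64 * t\<^sup>2 * ((x$1)^(2*0) * (x$2)^(2*2) * exp (- (t + 1) * (norm x)\<^sup>2)) +
        64 * t * ((x$1)^(2*1) * (x$2)^(2*0) * exp (- (t + 1) * (norm x)\<^sup>2)) +
        64 * t * ((x$1)^(2*0) * (x$2)^(2*1) * exp (- (t + 1) * (norm x)\<^sup>2)) +
        8 * ((x$1)^(2*0) * (x$2)^(2*0) * exp (- (t + 1) * (norm x)\<^sup>2)))
      (64 * t\<^sup>2 * ?M 2 0 + 128 * t\<^sup>2 * ?M 1 1 + 64 * t\<^sup>2 * ?M 0 2 + 64 * t * ?M 1 0 + 64 * t * ?M 0 1 + 8 * ?M 0 0)"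
      by (intro has_bochner_integral_add has_bochner_integral_mult_right G)
    also have "64 * t\<^sup>2 * ?M 2 0 + 128 * t\<^sup>2 * ?M 1 1 + 64 * t\<^sup>2 * ?M 0 2 + 64 * t * ?M 1 0 + 64 * t * ?M 0 1 + 8 * ?M 0 0 = I t"
      unfolding I_def gaussian_moment_small by (simp only: poly)
    finally show "has_bochner_integral lborel
        (\<lambda>x. laplace_density t (z1sq x) * 1 * exp (- (t + 1) * (norm x)\<^sup>2)) (I t)"
      unfolding laplace_density_def z1sq_def expand .
    define s where "s = 1 / (t + 1)"
    have s': "((\<lambda>t. 1 / (t + 1)) has_real_derivative - s\<^sup>2) (at t)"
      using l by (auto intro!: derivative_eq_intros simp: s_def power2_eq_square)
    have ts: "t * s = 1 - s"
      using l by (simp add: s_def field_simps)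
    have "DERIV F t :> 8 * pi^3 / 6 * (- 75 * (2 * s * (- s\<^sup>2)) + 80 * (3 * s\<^sup>2 * (- s\<^sup>2)) - 24 * (4 * s^3 * (- s\<^sup>2)))"
      unfolding F_def[abs_def] by (rule derivative_eq_intros s' refl | simp add: s_def)+
    also have "- 75 * (2 * s * (- s\<^sup>2)) + 80 * (3 * s\<^sup>2 * (- s\<^sup>2)) - 24 * (4 * s^3 * (- s\<^sup>2)) = 6 * (s^3 * (16 * t\<^sup>2 * s\<^sup>2 + 8 * t * s + 1))"
      using ts by algebra
    also have "8 * pi^3 / 6 * (6 * z) = 8 * pi^3 * z" for z :: real
      by simp
    also have "8 * pi^3 * (s^3 * (16 * t\<^sup>2 * s\<^sup>2 + 8 * t * s + 1)) = I t"
      by (simp add: I_def s_def power_divide)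
    finally show "DERIV F t :> I t" .
  next
    show "(F \<longlongrightarrow> 0) at_top"
      unfolding F_def[abs_def] by real_asymp
  qed (auto simp: I_def)
  then show ?thesis by (simp add: F_def)
qed

lemma integral_against_weighted_gaussian:
  "has_bochner_integral lborel
    (\<lambda>x. 8 * (4 * z1sq x + (norm x)\<^sup>2)\<^sup>2 / (norm x)^6 * (2 * (x$1)\<^sup>2 * exp (- (norm x)\<^sup>2)))
    (392 / 15 * pi^3)"
proof -
  define I where "I t = 8 * (pi / (t + 1))^3 *
    (48 * t\<^sup>2 * (1 / (t + 1))^3 + 16 * t * (1 / (t + 1))\<^sup>2 + 1 / (t + 1))" for t :: real
  define F where "F t = 8 * pi^3 / 15 *
    (- 325 * (1 / (t + 1))^3 + 420 * (1 / (t + 1))^4 - 144 * (1 / (t + 1))^5)" for t :: real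
  have "has_bochner_integral lborel
    (\<lambda>x. 8 * (4 * z1sq x + (norm x)\<^sup>2)\<^sup>2 / (norm x)^6 * (2 * (x$1)\<^sup>2 * exp (- (norm x)\<^sup>2))) (0 - F 0)"
  proof (rule laplace_weighted_integral)
    fix t :: real assume t: "0 \<le> t"
    then have l: "0 < t + 1" by simp
    note G = has_bochner_integral_gaussian_monomial[OF l]
    let ?M = "\<lambda>i j. (pi / (t + 1))^3 * (gaussian_moment (t + 1) i * gaussian_moment (t + 1) j)"
    \<comment> \<open>the exponents stay in the form \<open>2 * k\<close>, as in the formula for the moments\<close>
    have exponents: "2 * 0 = (0::nat)" "2 * 1 = (2::nat)" "2 * 2 = (4::nat)" "2 * 3 = (6::nat)"
      by simp_all
    have expand: "8 * (8 * (a\<^sup>2 + b\<^sup>2)\<^sup>2 * t\<^sup>2 + 8 * (a\<^sup>2 + b\<^sup>2) * t + 1) * (2 * a\<^sup>2) * e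
        = 128 * t\<^sup>2 * (a^(2*3) * b^(2*0) * e) + 256 * t\<^sup>2 * (a^(2*2) * b^(2*1) * e) +
          128 * t\<^sup>2 * (a^(2*1) * b^(2*2) * e) + 128 * t * (a^(2*2) * b^(2*0) * e) +
          128 * t * (a^(2*1) * b^(2*1) * e) + 16 * (a^(2*1) * b^(2*0) * e)" for a b e :: real
      unfolding exponents power_0 by algebra
    have poly: "128 * t\<^sup>2 * (p * (15 / 8 * s^3 * 1)) + 256 * t\<^sup>2 * (p * (3 / 4 * s\<^sup>2 * (1 / 2 * s)))
        + 128 * t\<^sup>2 * (p * (1 / 2 * s * (3 / 4 * s\<^sup>2))) + 128 * t * (p * (3 / 4 * s\<^sup>2 * 1))
        + 128 * t * (p * (1 / 2 * s * (1 / 2 * s))) + 16 * (p * (1 / 2 * s * 1))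
        = 8 * p * (48 * t\<^sup>2 * s^3 + 16 * t * s\<^sup>2 + s)" for p s :: real
      by (simp add: algebra_simps power2_eq_square power3_eq_cube)
    have "has_bochner_integral lborel
      (\<lambda>x :: real^6. 128 * t\<^sup>2 * ((x$1)^(2*3) * (x$2)^(2*0) * exp (- (t + 1) * (norm x)\<^sup>2)) +
        256 * t\<^sup>2 * ((x$1)^(2*2) * (x$2)^(2*1) * exp (- (t + 1) * (norm x)\<^sup>2)) +
        128 * t\<^sup>2 * ((x$1)^(2*1) * (x$2)^(2*2) * exp (- (t + 1) * (norm x)\<^sup>2)) +
        128 * t * ((x$1)^(2*2) * (x$2)^(2*0) * exp (- (t + 1) * (norm x)\<^sup>2)) +
        128 * t * ((x$1)^(2*1) * (x$2)^(2*1) * exp (- (t + 1) * (norm x)\<^sup>2)) +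
        16 * ((x$1)^(2*1) * (x$2)^(2*0) * exp (- (t + 1) * (norm x)\<^sup>2)))
      (128 * t\<^sup>2 * ?M 3 0 + 256 * t\<^sup>2 * ?M 2 1 + 128 * t\<^sup>2 * ?M 1 2 + 128 * t * ?M 2 0 + 128 * t * ?M 1 1 + 16 * ?M 1 0)"
      by (intro has_bochner_integral_add has_bochner_integral_mult_right G)
    also have "128 * t\<^sup>2 * ?M 3 0 + 256 * t\<^sup>2 * ?M 2 1 + 128 * t\<^sup>2 * ?M 1 2 + 128 * t * ?M 2 0 + 128 * t * ?M 1 1 + 16 * ?M 1 0 = I t"
      unfolding I_def gaussian_moment_small by (simp only: poly)
    finally show "has_bochner_integral lborel
        (\<lambda>x. laplace_density t (z1sq x) * (2 * (x$1)\<^sup>2) * exp (- (t + 1) * (norm x)\<^sup>2)) (I t)"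
      unfolding laplace_density_def z1sq_def expand .
    define s where "s = 1 / (t + 1)"
    have s': "((\<lambda>t. 1 / (t + 1)) has_real_derivative - s\<^sup>2) (at t)"
      using l by (auto intro!: derivative_eq_intros simp: s_def power2_eq_square)
    have ts: "t * s = 1 - s"
      using l by (simp add: s_def field_simps)
    have "DERIV F t :> 8 * pi^3 / 15 * (- 325 * (3 * s\<^sup>2 * (- s\<^sup>2)) + 420 * (4 * s^3 * (- s\<^sup>2)) - 144 * (5 * s^4 * (- s\<^sup>2)))"
      unfolding F_def[abs_def] by (rule derivative_eq_intros s' refl | simp add: s_def)+
    also have "- 325 * (3 * s\<^sup>2 * (- s\<^sup>2)) + 420 * (4 * s^3 * (- s\<^sup>2)) - 144 * (5 * s^4 * (- s\<^sup>2)) = 15 * (s^3 * (48 * t\<^sup>2 * s^3 + 16 * t * s\<^sup>2 + s))"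
      using ts by algebra
    also have "8 * pi^3 / 15 * (15 * z) = 8 * pi^3 * z" for z :: real
      by simp
    also have "8 * pi^3 * (s^3 * (48 * t\<^sup>2 * s^3 + 16 * t * s\<^sup>2 + s)) = I t"
      by (simp add: I_def s_def power_divide)
    finally show "DERIV F t :> I t" .
  next
    show "(F \<longlongrightarrow> 0) at_top"
      unfolding F_def[abs_def] by real_asymp
  qed (auto simp: I_def)
  then show ?thesis by (simp add: F_def)
qed

theorem lemma9:
  shows "\<exists>K :: (real^6) set.
    convex_body K \<and> infinitely_smooth K \<and> R_theta_invariant K \<and> K \<subseteq> ball 0 1 \<and>
    \<not> positive_definite (distribution_of
        (\<lambda>x. minkowski K x powi (-2) / (1 - (norm x / minkowski K x)\<^sup>2)))"
proof (intro exI[of _ body] conjI notI)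
  let ?f = "\<lambda>x. minkowski body x powi (-2) / (1 - (norm x / minkowski body x)\<^sup>2)"
  let ?c = "(pi / 4)^3 / 8"
  let ?\<psi> = "\<lambda>x. ?c * ((1 - 2 * (x$1)\<^sup>2) * exp (- (norm x)\<^sup>2))"
  assume "positive_definite (distribution_of ?f)"
  then have "distribution_of ?f (Defs.convolution test_function (\<lambda>x. cnj (test_function (- x)))) \<in> \<real>\<^sub>\<ge>\<^sub>0"
    using schwartz_test_function by (simp add: positive_definite_def)
  also have "distribution_of ?f (Defs.convolution test_function (\<lambda>x. cnj (test_function (- x))))
      = (LINT x|lborel. complex_of_real (?f x * ?\<psi> x))"
    unfolding distribution_of_def convolution_test_function by simp
  also have "\<dots> = complex_of_real (LINT x|lborel. ?f x * ?\<psi> x)"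
    by (rule integral_complex_of_real)
  also have "(LINT x|lborel. ?f x * ?\<psi> x) = ?c * (76 / 3 * pi^3 - 392 / 15 * pi^3)"
  proof (rule has_bochner_integral_integral_eq)
    show "has_bochner_integral lborel (\<lambda>x. ?f x * ?\<psi> x) (?c * (76 / 3 * pi^3 - 392 / 15 * pi^3))"
      using has_bochner_integral_mult_right[OF has_bochner_integral_diff[OF integral_against_gaussian
          integral_against_weighted_gaussian], of ?c]
      unfolding distribution_density
      by (rule back_subst[of "\<lambda>f. has_bochner_integral lborel f _"]) (auto simp: algebra_simps)
  qed
  finally have "0 \<le> ?c * (76 / 3 * pi^3 - 392 / 15 * pi^3)"
    by (simp only: nonneg_Reals_of_real_iff)
  moreover have "?c * (76 / 3 * pi^3 - 392 / 15 * pi^3) < 0"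
    by (intro mult_pos_neg) auto
  ultimately show False by linarith
qed (rule convex_body_body infinitely_smooth_body R_theta_invariant_body body_subset_ball)+

end
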